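(* Let $d\ge1$ and let $$\mathcal{C}_d=\mathrm{conv}\bigl\{(\cos\theta,\sin\theta,\cos2\theta,\sin2\theta,\dots,\cos d\theta,\sin d\theta)\in\mathbb{R}^{2d}:\theta\in[0,2\pi)\bigr\}$$ be the universal Carathéodory orbitope. Then $\mathcal{C}_d$ is isomorphic to the spectrahedron of positive semidefinite Hermitian Toeplitz matrices of size $(d+1)\times(d+1)$ with ones along the diagonal, where a point $(c_1,s_1,\dots,c_d,s_d)\in\mathbb{R}^{2d}$ corresponds to the matrix $$\begin{pmatrix}1&x_1&\cdots&x_{d-1}&x_d\\ y_1&1&\ddots&x_{d-2}&x_{d-1}\\ \vdots&\ddots&\ddots&\ddots&\vdots\\ y_{d-1}&y_{d-2}&\ddots&1&x_1\\ y_d&y_{d-1}&\cdots&y_1&1\end{pmatrix},\qquad x_j=c_j+s_j\,i,\quad y_j=c_j-s_j\,i,\quad i=\sqrt{-1}.$$ That is, $(c_1,s_1,\dots,c_d,s_d)\in\mathcal{C}_d$ if and only if this matrix is positive semidefinite.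
   Context: $\mathrm{conv}$ denotes the convex hull. A complex Hermitian linear matrix inequality is regarded as defining a spectrahedron via the equivalence: for $F$ real symmetric and $G$ real skew-symmetric, the Hermitian matrix $F+Gi$ is positive semidefinite if and only if $\begin{pmatrix}F & -G \\ G & F\end{pmatrix}\succeq0$. *)

theory Defs
  imports "HOL-Analysis.Analysis"
begin

text \<open>
  The number \<open>d \<ge> 1\<close> is the cardinality of a finite linearly ordered index type \<open>'d\<close>; every
  \<open>d \<ge> 1\<close> occurs, for instance as the numeral type \<open>d\<close>. A point
  \<open>(c\<^sub>1, s\<^sub>1, \<dots>, c\<^sub>d, s\<^sub>d)\<close> of \<open>\<real>\<^bsup>2d\<^esup>\<close> is a vector \<open>p :: (real \<times> real) ^ 'd\<close> of \<open>d\<close> consecutive pairs,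
  and the \<open>d + 1\<close> rows and columns of a matrix are indexed by \<open>'d option\<close>, with \<open>None\<close> first.
\<close>

definition pos :: "'d::{finite,linorder} \<Rightarrow> nat"
  where "pos j = card {k. k \<le> j}"

lemma strict_mono_pos: "strict_mono (pos :: 'd::{finite,linorder} \<Rightarrow> nat)"
proof (rule strict_monoI)
  fix i j :: 'd assume ij: "i < j"
  then have "{k. k \<le> i} \<subset> {k. k \<le> j}"
    by (auto simp: psubset_eq dest: order.strict_trans1)
  then show "pos i < pos j"
    unfolding pos_def by (intro psubset_card_mono) auto
qed

lemma bij_betw_pos: "bij_betw (pos :: 'd::{finite,linorder} \<Rightarrow> nat) UNIV {1..CARD('d)}"
proof -
  have inj: "inj (pos :: 'd \<Rightarrow> nat)"
    by (rule strict_mono_imp_inj_on) (rule strict_mono_pos)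
  have "range (pos :: 'd \<Rightarrow> nat) \<subseteq> {1..CARD('d)}"
  proof
    fix n assume "n \<in> range (pos :: 'd \<Rightarrow> nat)"
    then obtain j :: 'd where n: "n = card {k. k \<le> j}"
      unfolding pos_def by blast
    have "card {k. k \<le> j} > 0" by (auto simp: card_gt_0_iff)
    moreover have "card {k. k \<le> j} \<le> CARD('d)" by (rule card_mono) auto
    ultimately show "n \<in> {1..CARD('d)}" using n by simp
  qed
  moreover have "card (range (pos :: 'd \<Rightarrow> nat)) = card {1..CARD('d)}"
    by (simp add: card_image[OF inj])
  ultimately have "range (pos :: 'd \<Rightarrow> nat) = {1..CARD('d)}"
    by (intro card_subset_eq) auto
  with inj show ?thesis by (simp add: bij_betw_def)
qed

definition trig_curve :: "real \<Rightarrow> (real \<times> real) ^ ('d::{finite,linorder})"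
  where "trig_curve \<theta> = (\<chi> j. (cos (real (pos j) * \<theta>), sin (real (pos j) * \<theta>)))"

definition caratheodory_orbitope :: "((real \<times> real) ^ ('d::{finite,linorder})) set"
  where "caratheodory_orbitope = convex hull (trig_curve ` {0..<2 * pi})"

definition x_coeff :: "(real \<times> real) ^ ('d::{finite,linorder}) \<Rightarrow> nat \<Rightarrow> complex"
  where "x_coeff p k = Complex (fst (p $ inv pos k)) (snd (p $ inv pos k))"

definition y_coeff :: "(real \<times> real) ^ ('d::{finite,linorder}) \<Rightarrow> nat \<Rightarrow> complex"
  where "y_coeff p k = Complex (fst (p $ inv pos k)) (- snd (p $ inv pos k))"

fun index :: "'d::{finite,linorder} option \<Rightarrow> nat" where
  "index None = 0"
| "index (Some j) = pos j"

definition toeplitz_matrix ::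
    "(real \<times> real) ^ ('d::{finite,linorder}) \<Rightarrow> complex ^ 'd option ^ 'd option"
  where "toeplitz_matrix p = (\<chi> m n.
    if index m < index n then x_coeff p (index n - index m)
    else if index n < index m then y_coeff p (index m - index n)
    else 1)"

definition hermitian :: "complex ^ 'n ^ 'n \<Rightarrow> bool"
  where "hermitian A \<longleftrightarrow> (\<forall>i j. A $ j $ i = cnj (A $ i $ j))"

text \<open>For a Hermitian matrix the sum below is real, so that taking the real part loses nothing.\<close>

definition hermitian_psd :: "complex ^ 'n ^ 'n \<Rightarrow> bool"
  where "hermitian_psd A \<longleftrightarrow> hermitian A \<and>
    (\<forall>v. 0 \<le> Re (\<Sum>i\<in>UNIV. \<Sum>j\<in>UNIV. cnj (v $ i) * A $ i $ j * v $ j))"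

definition real_psd :: "real ^ 'n ^ 'n \<Rightarrow> bool"
  where "real_psd A \<longleftrightarrow> transpose A = A \<and> (\<forall>v. 0 \<le> v \<bullet> (A *v v))"

text \<open>For \<open>A = F + G i\<close> this is the real block matrix with rows \<open>(F, -G)\<close> and \<open>(G, F)\<close>.\<close>

definition real_block :: "complex ^ 'n ^ 'n \<Rightarrow> real ^ ('n + 'n) ^ ('n + 'n)"
  where "real_block A = (\<chi> a b. case (a, b) of
      (Inl i, Inl j) \<Rightarrow> Re (A $ i $ j)
    | (Inl i, Inr j) \<Rightarrow> - Im (A $ i $ j)
    | (Inr i, Inl j) \<Rightarrow> Im (A $ i $ j)
    | (Inr i, Inr j) \<Rightarrow> Re (A $ i $ j))"

definition is_toeplitz :: "complex ^ ('d::{finite,linorder}) option ^ 'd option \<Rightarrow> bool"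
  where "is_toeplitz A \<longleftrightarrow> (\<forall>i j k l. int (index i) - int (index j) = int (index k) - int (index l)
    \<longrightarrow> A $ i $ j = A $ k $ l)"

definition toeplitz_spectrahedron :: "(complex ^ ('d::{finite,linorder}) option ^ 'd option) set"
  where "toeplitz_spectrahedron = {A. hermitian_psd A \<and> is_toeplitz A \<and> (\<forall>i. A $ i $ i = 1)}"

definition affine_iso_betw ::
    "('a::real_vector \<Rightarrow> 'b::real_vector) \<Rightarrow> 'a set \<Rightarrow> 'b set \<Rightarrow> bool"
  where "affine_iso_betw f S T \<longleftrightarrow> linear (\<lambda>x. f x - f 0) \<and> bij_betw f S T"

lemma transpose_real_block: "transpose (real_block A) = real_block A \<longleftrightarrow> hermitian A"
proof
  assume sym: "transpose (real_block A) = real_block A"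
  have eq: "real_block A $ b $ a = real_block A $ a $ b" for a b
  proof -
    have "real_block A $ b $ a = transpose (real_block A) $ a $ b"
      by (simp add: transpose_def)
    then show ?thesis by (simp only: sym)
  qed
  show "hermitian A"
    unfolding hermitian_def
  proof (intro allI)
    fix i j
    show "A $ j $ i = cnj (A $ i $ j)"
      using eq[of "Inl i" "Inl j"] eq[of "Inl i" "Inr j"]
      by (simp add: real_block_def complex_eq_iff)
  qed
next
  assume "hermitian A"
  then have re: "Re (A $ j $ i) = Re (A $ i $ j)" and im: "Im (A $ j $ i) = - Im (A $ i $ j)" for i j
    unfolding hermitian_def complex_eq_iff cnj.simps by blast+
  have "real_block A $ b $ a = real_block A $ a $ b" for a b
  proof (cases a; cases b)
    fix i j assume "a = Inl i" "b = Inl j"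
    then show ?thesis using re[of i j] by (simp add: real_block_def)
  next
    fix i j assume "a = Inl i" "b = Inr j"
    then show ?thesis using im[of i j] by (simp add: real_block_def)
  next
    fix i j assume "a = Inr i" "b = Inl j"
    then show ?thesis using im[of i j] by (simp add: real_block_def)
  next
    fix i j assume "a = Inr i" "b = Inr j"
    then show ?thesis using re[of i j] by (simp add: real_block_def)
  qed
  then show "transpose (real_block A) = real_block A"
    by (simp add: vec_eq_iff transpose_def)
qed

lemma real_block_quadratic_form:
  fixes A :: "complex ^ 'n ^ 'n" and w :: "real ^ ('n + 'n)"
  shows "w \<bullet> (real_block A *v w) = Re (\<Sum>i\<in>UNIV. \<Sum>j\<in>UNIV.
    cnj (Complex (w $ Inl i) (w $ Inr i)) * A $ i $ j * Complex (w $ Inl j) (w $ Inr j))"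
proof -
  have sum_UNIV: "sum f UNIV = (\<Sum>i\<in>UNIV. f (Inl i)) + (\<Sum>i\<in>UNIV. f (Inr i))"
    for f :: "'n + 'n \<Rightarrow> real"
    by (simp add: UNIV_Plus_UNIV[symmetric] sum.Plus del: UNIV_Plus_UNIV)
  show ?thesis
    unfolding inner_vec_def matrix_vector_mult_def sum_UNIV Re_sum real_block_def
      sum.distrib[symmetric] vec_lambda_beta inner_real_def sum_distrib_left
    by (intro sum.cong refl) (simp add: algebra_simps)
qed

lemma hermitian_psd_iff_real_psd: "hermitian_psd A \<longleftrightarrow> real_psd (real_block A)"
proof -
  have "(\<forall>v. 0 \<le> Re (\<Sum>i\<in>UNIV. \<Sum>j\<in>UNIV. cnj (v $ i) * A $ i $ j * v $ j))
    \<longleftrightarrow> (\<forall>w. 0 \<le> w \<bullet> (real_block A *v w))" (is "?L \<longleftrightarrow> ?R")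
  proof
    assume l: ?L
    show ?R
    proof
      fix w
      show "0 \<le> w \<bullet> (real_block A *v w)"
        using l[rule_format, of "\<chi> i. Complex (w $ Inl i) (w $ Inr i)"]
        by (simp only: real_block_quadratic_form vec_lambda_beta)
    qed
  next
    assume r: ?R
    show ?L
    proof
      fix v
      show "0 \<le> Re (\<Sum>i\<in>UNIV. \<Sum>j\<in>UNIV. cnj (v $ i) * A $ i $ j * v $ j)"
        using r[rule_format, of "\<chi> a. case a of Inl i \<Rightarrow> Re (v $ i) | Inr i \<Rightarrow> Im (v $ i)"]
        by (simp only: real_block_quadratic_form vec_lambda_beta sum.case complex_surj)
    qed
  qed
  then show ?thesis
    unfolding hermitian_psd_def real_psd_def transpose_real_block by blast
qed

end

theory Submission
  imports Defs "HOL-Computational_Algebra.Fundamental_Theorem_Algebra"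
begin

text \<open>
  Write \<open>u\<^sub>k = exp (i k \<theta>)\<close>. The matrix of a point of the trigonometric curve has entries
  \<open>cnj u\<^sub>m * u\<^sub>n\<close>, hence its quadratic form at \<open>v\<close> is \<open>|\<Sum>\<^sub>n u\<^sub>n v\<^sub>n|\<^sup>2 \<ge> 0\<close>. As the matrix depends
  affinely on the point, the whole orbitope consists of points with positive semidefinite matrix.

  The converse is by duality. The orbitope is compact and convex, so a point \<open>p\<close> outside it is
  strictly separated from it by an affine functional: negative at \<open>p\<close>, positive on the curve.
  Along the curve this functional is a trigonometric polynomial of degree at most \<open>d\<close> in \<open>\<theta>\<close>,
  strictly positive everywhere. By the Fejer-Riesz theorem (\<open>fejer_riesz\<close>) it equals
  \<open>|g (exp (i \<theta>))|\<^sup>2\<close> for a polynomial \<open>g\<close> of degree at most \<open>d\<close>. Both sides are Laurent polynomials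
  in \<open>exp (i \<theta>)\<close>; replacing each power \<open>exp (i k \<theta>)\<close> by the corresponding coordinate \<open>c\<^sub>k + s\<^sub>k i\<close> of \<open>p\<close>
  turns the left-hand side into the negative value of the functional at \<open>p\<close>, and the right-hand
  side into the quadratic form of the Toeplitz matrix of \<open>p\<close> at the coefficient vector of \<open>g\<close>
  (\<open>riesz_functional_square\<close>). So this matrix is not positive semidefinite.

  Finally, a Hermitian Toeplitz matrix with unit diagonal is determined by its first row, which
  can be prescribed freely; this gives the affine bijection.
\<close>

section \<open>The Fejer-Riesz factorization\<close>

lemma poly_eq_if_eq_on_circle:
  fixes P Q :: "complex poly"
  assumes "\<And>z. norm z = 1 \<Longrightarrow> poly P z = poly Q z"
  shows "P = Q"
proof (rule ccontr)
  assume "P \<noteq> Q"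
  then have "finite {z. poly (P - Q) z = 0}"
    by (intro poly_roots_finite) simp
  moreover have "sphere 0 1 \<subseteq> {z. poly (P - Q) z = 0}"
    using assms by auto
  ultimately have "finite (sphere (0::complex) 1)"
    by (rule rev_finite_subset)
  then obtain a where "sphere (0::complex) 1 \<subseteq> {a}"
    using connected_finite_iff_sing[OF connected_sphere[of "0::complex" 1]] by auto
  moreover have "1 \<in> sphere (0::complex) 1" "-1 \<in> sphere (0::complex) 1"
    by simp_all
  ultimately have "(1::complex) = - 1" by blast
  then show False by simp
qed

lemma poly_eq_sum:
  fixes p :: "'a::comm_semiring_1 poly"
  assumes "degree p \<le> n"
  shows "poly p x = (\<Sum>k\<le>n. coeff p k * x ^ k)"
  by (subst poly_as_sum_of_monoms'[OF assms, symmetric]) (simp only: poly_sum poly_monom)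

text \<open>
  The polynomial \<open>z\<^sup>n * cnj (g (1 / cnj z))\<close>. On the unit circle \<open>1 / cnj z = z\<close>, so that
  \<open>g * conj_reciprocal n g\<close> is there \<open>z\<^sup>n |g z|\<^sup>2\<close>: this is how the non-holomorphic function \<open>|g|\<^sup>2\<close>
  is expressed by a polynomial.
\<close>

definition conj_reciprocal :: "nat \<Rightarrow> complex poly \<Rightarrow> complex poly"
  where "conj_reciprocal n g = (\<Sum>k\<le>n. monom (cnj (coeff g k)) (n - k))"

lemma poly_conj_reciprocal:
  assumes "degree g \<le> n" "z \<noteq> 0"
  shows "poly (conj_reciprocal n g) z = z ^ n * cnj (poly g (inverse (cnj z)))"
proof -
  have "poly g w = (\<Sum>k\<le>n. coeff g k * w ^ k)" for w
    using assms(1) by (rule poly_eq_sum)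
  then show ?thesis
    using assms(2)
    by (simp add: conj_reciprocal_def poly_sum poly_monom sum_distrib_left power_diff
        power_inverse field_simps)
qed

lemma poly_conj_reciprocal_circle:
  assumes "degree g \<le> n" "norm z = 1"
  shows "poly (conj_reciprocal n g) z = z ^ n * cnj (poly g z)"
proof -
  have "z \<noteq> 0" using assms(2) by auto
  moreover have "inverse (cnj z) = z"
    using assms(2) by (simp add: inverse_complex_def complex_eq_iff cmod_def)
  ultimately show ?thesis
    using poly_conj_reciprocal[OF assms(1)] by simp
qed

lemma coeff_conj_reciprocal:
  assumes "k \<le> n"
  shows "coeff (conj_reciprocal n g) k = cnj (coeff g (n - k))"
proof -
  have "coeff (conj_reciprocal n g) k = (\<Sum>i\<le>n. if i = n - k then cnj (coeff g i) else 0)"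
    using assms unfolding conj_reciprocal_def coeff_sum
    by (intro sum.cong) auto
  then show ?thesis by simp
qed

text \<open>
  A trigonometric polynomial of degree at most \<open>d\<close> is represented by the polynomial \<open>P\<close> of degree
  at most \<open>2 d\<close> that is \<open>z\<^sup>d\<close> times it. Being real on the circle makes \<open>P\<close> equal to its own
  conjugate reciprocal, so its nonzero roots come in pairs \<open>a\<close>, \<open>1 / cnj a\<close>. Positivity keeps them off
  the circle, so that the two members of a pair differ and both linear factors can be split
  off; on the circle their product is \<open>z |z - a|\<^sup>2\<close> up to a constant. Dividing by it lowers \<open>d\<close> by
  one and preserves positivity, and \<open>z - a\<close> becomes a factor of \<open>g\<close>.
\<close>

lemma fejer_riesz:
  fixes P :: "complex poly"
  assumes "degree P \<le> 2 * d"
    and "\<And>z. norm z = 1 \<Longrightarrow> \<exists>r>0. poly P z = of_real r * z ^ d"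
  shows "\<exists>g. degree g \<le> d \<and> P = g * conj_reciprocal d g"
proof -
  have "\<exists>g. degree g \<le> d \<and> (\<forall>z. norm z = 1 \<longrightarrow> poly P z = of_real ((norm (poly g z))\<^sup>2) * z ^ d)"
    using assms
  proof (induction d arbitrary: P)
    case 0
    then obtain c where P: "P = [:c:]"
      using degree_eq_zeroE[of P] by auto
    obtain r where "r > 0" "c = of_real r"
      using "0.prems"(2)[of 1] P by auto
    then have "degree [:of_real (sqrt r) :: complex:] \<le> 0 \<and>
      (\<forall>z. norm z = 1 \<longrightarrow> poly P z = of_real ((norm (poly [:of_real (sqrt r):] z))\<^sup>2) * z ^ 0)"
      using P by (simp del: of_real_power)
    then show ?case by blast
  next
    case (Suc d)
    have self_reciprocal: "conj_reciprocal (2 * Suc d) P = P"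
    proof (rule poly_eq_if_eq_on_circle)
      fix z :: complex assume z: "norm z = 1"
      then obtain r where r: "poly P z = of_real r * z ^ Suc d"
        using Suc.prems(2) by blast
      have zz: "z * cnj z = 1" using z by (simp add: complex_norm_square[symmetric])
      have "poly (conj_reciprocal (2 * Suc d) P) z = z ^ (2 * Suc d) * (of_real r * cnj z ^ Suc d)"
        using poly_conj_reciprocal_circle[OF Suc.prems(1) z] r by simp
      also have "\<dots> = of_real r * z ^ Suc d * (z * cnj z) ^ Suc d"
        by (simp only: power_mult_distrib mult_2 power_add) (simp add: mult_ac)
      also have "\<dots> = poly P z" using zz r by simp
      finally show "poly (conj_reciprocal (2 * Suc d) P) z = poly P z" .
    qed
    have P_circle: "poly P z \<noteq> 0" if z: "norm z = 1" for z
      using Suc.prems(2)[OF z] z by auto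
    then have P0: "P \<noteq> 0" using norm_one by (metis poly_0)
    show ?case
    proof (cases "coeff P 0 = 0")
      case True
      \<comment> \<open>By self-reciprocity the coefficient of degree \<open>2 (d + 1)\<close> vanishes as well, so that dividing
        by \<open>z\<close> lowers the degree bound by two.\<close>
      then obtain Q where Q: "P = pCons 0 Q"
        by (cases P) auto
      have "coeff P (2 * Suc d) = cnj (coeff P 0)"
        using coeff_conj_reciprocal[of "2 * Suc d" "2 * Suc d" P] self_reciprocal by simp
      then have "coeff P (2 * Suc d) = 0" using True by simp
      then have "degree P \<noteq> 2 * Suc d" using P0 by (metis leading_coeff_0_iff)
      then have "degree Q \<le> 2 * d"
        using Suc.prems(1) P0 unfolding Q by (auto simp: degree_pCons_eq_if split: if_splits)
      moreover have "\<exists>r>0. poly Q z = of_real r * z ^ d" if z: "norm z = 1" for z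
      proof -
        obtain r where "r > 0" "poly P z = of_real r * z ^ Suc d"
          using Suc.prems(2)[OF z] by blast
        moreover have "z \<noteq> 0" using z by auto
        ultimately show ?thesis unfolding Q by auto
      qed
      ultimately obtain g where g: "degree g \<le> d"
        "\<And>z. norm z = 1 \<Longrightarrow> poly Q z = of_real ((norm (poly g z))\<^sup>2) * z ^ d"
        using Suc.IH by blast
      then show ?thesis
        unfolding Q by (intro exI[of _ g]) auto
    next
      case False
      have "coeff P (2 * Suc d) \<noteq> 0"
        using coeff_conj_reciprocal[of "2 * Suc d" "2 * Suc d" P] self_reciprocal False by simp
      then have degP: "degree P = 2 * Suc d"
        using Suc.prems(1) le_degree[of P "2 * Suc d"] by (simp add: le_antisym)
      then obtain a where a: "poly P a = 0"
        using fundamental_theorem_of_algebra[of P] by (auto simp: constant_degree)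
      have a0: "a \<noteq> 0" using a False by (auto simp: poly_0_coeff_0)
      define b where "b = inverse (cnj a)"
      have b: "poly P b = 0"
        using poly_conj_reciprocal[OF Suc.prems(1), of b] a0 a self_reciprocal
        by (simp add: b_def)
      have "a \<noteq> b"
      proof
        assume "a = b"
        then have "a * cnj a = inverse (cnj a) * cnj a" by (simp only: b_def)
        then have "a * cnj a = 1" using a0 by simp
        then have "of_real ((norm a)\<^sup>2) = (of_real 1 :: complex)"
          by (simp only: complex_norm_square of_real_1)
        then have "(norm a)\<^sup>2 = 1" by (simp only: of_real_eq_iff)
        then have "norm a = 1" by (simp add: power2_eq_1_iff) (smt (verit) norm_ge_zero)
        then show False using P_circle a by blast
      qed
      obtain P1 where P1: "P = [:-a, 1:] * P1"
        using a by (auto simp: poly_eq_0_iff_dvd dvd_def)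
      then have "poly P1 b = 0" using b \<open>a \<noteq> b\<close> by auto
      then obtain P2 where P2: "P1 = [:-b, 1:] * P2"
        by (auto simp: poly_eq_0_iff_dvd dvd_def)
      \<comment> \<open>The scalar turns the factor \<open>z - 1 / cnj a\<close> into \<open>1 - cnj a * z\<close>, which on the circle is
        \<open>z * cnj (z - a)\<close>.\<close>
      define Q where "Q = smult (- inverse (cnj a)) P2"
      have "[:-b, 1:] = smult (- inverse (cnj a)) [:1, - cnj a:]"
        using a0 by (simp add: b_def)
      then have PQ: "P = [:-a, 1:] * [:1, - cnj a:] * Q"
        unfolding P1 P2 Q_def by (simp only: mult_smult_left mult_smult_right mult.assoc)
      have P2_0: "P2 \<noteq> 0" using P0 P1 P2 by auto
      have "degree P = Suc (Suc (degree P2))"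
        unfolding P1 P2 using P2_0 by (simp add: degree_mult_eq del: mult_pCons_left)
      then have "degree Q \<le> 2 * d"
        using degP by (simp add: Q_def)
      moreover have P_eq: "poly P z = of_real ((norm (z - a))\<^sup>2) * z * poly Q z" if z: "norm z = 1" for z
      proof -
        have zz: "z * cnj z = 1" using z by (simp add: complex_norm_square[symmetric])
        have "(1 - cnj a * z) = z * cnj (z - a)"
          using zz by (simp add: algebra_simps)
        moreover have "poly P z = (z - a) * (1 - cnj a * z) * poly Q z"
          unfolding PQ by (simp add: algebra_simps)
        ultimately show ?thesis
          by (simp add: complex_norm_square mult_ac del: complex_cnj_diff of_real_power)
      qed
      moreover have "\<exists>r>0. poly Q z = of_real r * z ^ d" if z: "norm z = 1" for z
      proof -
        obtain r where r: "r > 0" "poly P z = of_real r * z ^ Suc d"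
          using Suc.prems(2)[OF z] by blast
        have z0: "z \<noteq> 0" using z by auto
        have za: "norm (z - a) \<noteq> 0" using P_circle[OF z] a by auto
        have "z * (of_real ((norm (z - a))\<^sup>2) * poly Q z) = z * (of_real r * z ^ d)"
          using trans[OF P_eq[OF z, symmetric] r(2)] by (simp only: power_Suc mult_ac)
        then have "of_real ((norm (z - a))\<^sup>2) * poly Q z = of_real r * z ^ d"
          using z0 by (simp only: mult_cancel_left simp_thms)
        moreover have "(of_real ((norm (z - a))\<^sup>2) :: complex) \<noteq> 0"
          using za by simp
        ultimately have "poly Q z = of_real (r / (norm (z - a))\<^sup>2) * z ^ d"
          by (simp add: nonzero_eq_divide_eq mult_ac del: of_real_power)
        moreover have "r / (norm (z - a))\<^sup>2 > 0" using r za by simp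
        ultimately show ?thesis by blast
      qed
      ultimately obtain g where g: "degree g \<le> d"
        "\<And>z. norm z = 1 \<Longrightarrow> poly Q z = of_real ((norm (poly g z))\<^sup>2) * z ^ d"
        using Suc.IH by blast
      have "degree ([:-a, 1:] * g) \<le> Suc d"
        using degree_mult_le[of "[:-a, 1:]" g] g(1) by simp
      moreover have "poly P z = of_real ((norm (poly ([:-a, 1:] * g) z))\<^sup>2) * z ^ Suc d"
        if z: "norm z = 1" for z
      proof -
        have "poly ([:-a, 1:] * g) z = (z - a) * poly g z" by (simp add: algebra_simps)
        then show ?thesis
          using P_eq[OF z] g(2)[OF z] by (simp add: norm_mult power_mult_distrib mult_ac)
      qed
      ultimately show ?thesis by blast
    qed
  qed
  then obtain g where g: "degree g \<le> d"
    "\<And>z. norm z = 1 \<Longrightarrow> poly P z = of_real ((norm (poly g z))\<^sup>2) * z ^ d"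
    by blast
  have "P = g * conj_reciprocal d g"
  proof (rule poly_eq_if_eq_on_circle)
    fix z :: complex assume z: "norm z = 1"
    show "poly P z = poly (g * conj_reciprocal d g) z"
      using g(2)[OF z] poly_conj_reciprocal_circle[OF g(1) z]
      by (simp add: complex_norm_square mult_ac del: of_real_power)
  qed
  with g(1) show ?thesis by blast
qed

section \<open>Toeplitz matrices and their moments\<close>

text \<open>The space \<open>\<real>\<^bsup>2d\<^esup>\<close> of points \<open>(c\<^sub>1, s\<^sub>1, \<dots>, c\<^sub>d, s\<^sub>d)\<close>.\<close>

type_synonym 'd pairs = "(real \<times> real, 'd) vec"

text \<open>
  For a point of the curve, or a convex combination of such points, this is the \<open>k\<close>-th
  trigonometric moment \<open>\<integral> exp (i k \<theta>) d\<mu>\<close> of a probability measure \<open>\<mu>\<close> representing it. Indexing by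
  integers makes the entries of the Toeplitz matrix a single function of the index difference.
\<close>

definition moment :: "'d::{finite,linorder} pairs \<Rightarrow> int \<Rightarrow> complex"
  where "moment p k =
    (if k > 0 then x_coeff p (nat k) else if k < 0 then y_coeff p (nat (- k)) else 1)"

lemma inv_pos [simp]: "inv pos (pos j) = (j :: 'd::{finite,linorder})"
  by (simp add: strict_mono_imp_inj_on[OF strict_mono_pos])

lemma pos_range: "pos (j :: 'd::{finite,linorder}) > 0" "pos j \<le> CARD('d)"
  using bij_betw_apply[OF bij_betw_pos, of j] by auto

lemma pos_inv:
  assumes "0 < k" "k \<le> CARD('d)"
  shows "pos (inv pos k :: 'd::{finite,linorder}) = k"
  using assms bij_betw_imp_surj_on[OF bij_betw_pos[where 'd='d]]
  by (intro f_inv_into_f) auto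

lemma bij_betw_index: "bij_betw (index :: 'd::{finite,linorder} option \<Rightarrow> nat) UNIV {..CARD('d)}"
proof (rule bij_betw_imageI)
  show "inj (index :: 'd option \<Rightarrow> nat)"
  proof (rule injI)
    fix m n :: "'d option" assume "index m = index n"
    moreover have "pos j \<noteq> 0" for j :: 'd
      using pos_range(1)[of j] by simp
    moreover have "i = j" if "pos i = pos j" for i j :: 'd
      using that by (metis inv_pos)
    ultimately show "m = n"
      by (cases m; cases n) (simp, metis index.simps, metis index.simps, metis index.simps)
  qed
  have "{..CARD('d)} = insert 0 {1..CARD('d)}" by auto
  then show "range (index :: 'd option \<Rightarrow> nat) = {..CARD('d)}"
    using bij_betw_imp_surj_on[OF bij_betw_pos[where 'd='d]]
    by (simp add: UNIV_option_conv image_image)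
qed

lemma toeplitz_matrix_moment:
  "toeplitz_matrix p $ m $ n = moment p (int (index n) - int (index m))"
  by (auto simp: toeplitz_matrix_def moment_def nat_diff_distrib')

lemma moment_cnj: "moment p (- k) = cnj (moment p k)"
  by (auto simp: moment_def x_coeff_def y_coeff_def complex_eq_iff)

lemma hermitian_toeplitz_matrix: "hermitian (toeplitz_matrix p)"
  unfolding hermitian_def toeplitz_matrix_moment
  by (metis minus_diff_eq moment_cnj)

lemma moment_trig_curve:
  assumes "\<bar>k\<bar> \<le> int CARD('d)"
  shows "moment (trig_curve \<theta> :: 'd::{finite,linorder} pairs) k = cis (of_int k * \<theta>)"
proof -
  have "pos (inv pos (nat \<bar>k\<bar>) :: 'd) = nat \<bar>k\<bar>" if "k \<noteq> 0"
    using that assms by (intro pos_inv) auto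
  then show ?thesis
    by (auto simp: moment_def x_coeff_def y_coeff_def trig_curve_def complex_eq_iff abs_if
        split: if_splits)
qed

lemma moment_affine:
  assumes "u + v = 1"
  shows "moment (u *\<^sub>R p + v *\<^sub>R q) k = u *\<^sub>R moment p k + v *\<^sub>R moment q k"
proof -
  have "u *\<^sub>R (1 :: complex) + v *\<^sub>R 1 = 1"
    using assms by (simp flip: scaleR_left.add)
  then show ?thesis
    by (auto simp: moment_def x_coeff_def y_coeff_def intro!: complex_eqI)
qed

lemma linear_moment:
  "linear (\<lambda>p :: 'd::{finite,linorder} pairs. moment p k - moment (0 :: 'd pairs) k)"
  by (rule linearI) (auto simp: moment_def x_coeff_def y_coeff_def intro!: complex_eqI)

definition toeplitz_form :: "'d::{finite,linorder} pairs \<Rightarrow> complex ^ 'd option \<Rightarrow> complex"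
  where "toeplitz_form p v =
    (\<Sum>i\<in>UNIV. \<Sum>j\<in>UNIV. cnj (v $ i) * toeplitz_matrix p $ i $ j * v $ j)"

lemma hermitian_psd_toeplitz_iff:
  "hermitian_psd (toeplitz_matrix p) \<longleftrightarrow> (\<forall>v. 0 \<le> Re (toeplitz_form p v))"
  by (simp add: hermitian_psd_def hermitian_toeplitz_matrix toeplitz_form_def)

lemma toeplitz_form_affine:
  assumes "u + v = 1"
  shows "toeplitz_form (u *\<^sub>R p + v *\<^sub>R q) w = u *\<^sub>R toeplitz_form p w + v *\<^sub>R toeplitz_form q w"
  unfolding toeplitz_form_def toeplitz_matrix_moment moment_affine[OF assms] scaleR_sum_right
    sum.distrib[symmetric]
  by (intro sum.cong refl) (simp add: algebra_simps)

lemma index_diff_le: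
  "\<bar>int (index (n :: 'd::{finite,linorder} option)) - int (index (m :: 'd option))\<bar> \<le> int CARD('d)"
  using bij_betw_apply[OF bij_betw_index, of m] bij_betw_apply[OF bij_betw_index, of n] by auto

text \<open>On the curve the matrix has rank one.\<close>

lemma toeplitz_form_trig_curve:
  fixes v :: "complex ^ 'd::{finite,linorder} option"
  shows "toeplitz_form (trig_curve \<theta>) v =
    of_real ((norm (\<Sum>j\<in>UNIV. cis (real (index j) * \<theta>) * v $ j))\<^sup>2)"
proof -
  have "toeplitz_form (trig_curve \<theta>) v = (\<Sum>i\<in>UNIV. \<Sum>j\<in>UNIV.
      cnj (cis (real (index i) * \<theta>) * v $ i) * (cis (real (index j) * \<theta>) * v $ j))"
    unfolding toeplitz_form_def toeplitz_matrix_moment moment_trig_curve[OF index_diff_le]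
  proof (intro sum.cong refl)
    fix i j :: "'d option"
    have "cis (of_int (int (index j) - int (index i)) * \<theta>) =
        cnj (cis (real (index i) * \<theta>)) * cis (real (index j) * \<theta>)"
      by (simp add: cis_cnj cis_mult left_diff_distrib)
    then show "cnj (v $ i) * cis (of_int (int (index j) - int (index i)) * \<theta>) * v $ j =
        cnj (cis (real (index i) * \<theta>) * v $ i) * (cis (real (index j) * \<theta>) * v $ j)"
      by simp
  qed
  also have "\<dots> = cnj (\<Sum>j\<in>UNIV. cis (real (index j) * \<theta>) * v $ j) *
      (\<Sum>j\<in>UNIV. cis (real (index j) * \<theta>) * v $ j)"
    by (simp add: sum_product)
  finally show ?thesis
    by (simp only: complex_norm_square mult.commute)
qed

lemma caratheodory_orbitope_imp_psd:
  assumes "p \<in> caratheodory_orbitope"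
  shows "hermitian_psd (toeplitz_matrix p)"
proof -
  have "caratheodory_orbitope \<subseteq> {p :: 'a pairs. \<forall>v. 0 \<le> Re (toeplitz_form p v)}"
    unfolding caratheodory_orbitope_def
  proof (rule hull_minimal)
    show "convex {p :: 'a pairs. \<forall>v. 0 \<le> Re (toeplitz_form p v)}"
      by (rule convexI) (simp add: toeplitz_form_affine)
  qed (auto simp: toeplitz_form_trig_curve simp del: of_real_power)
  with assms show ?thesis
    by (auto simp: hermitian_psd_toeplitz_iff)
qed

section \<open>Positive semidefinite Toeplitz matrices\<close>

text \<open>
  The linear functional on Laurent polynomials that sends \<open>z\<^sup>k\<close> to the \<open>k\<close>-th moment of \<open>p\<close>, for
  \<open>|k| \<le> d\<close>. A Laurent polynomial is given as \<open>P / z\<^sup>d\<close>, whence the shift of the index. For a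
  representing measure it is integration, and for a point of the curve it is evaluation at
  \<open>exp (i \<theta>)\<close>.
\<close>

definition riesz_functional ::
    "'d::{finite,linorder} pairs \<Rightarrow> complex poly \<Rightarrow> complex"
  where "riesz_functional p P =
    (\<Sum>k\<le>2 * CARD('d). coeff P k * moment p (int k - int CARD('d)))"

lemma riesz_functional_monom:
  assumes "k \<le> 2 * CARD('d)"
  shows "riesz_functional p (monom c k) =
    c * moment (p :: 'd::{finite,linorder} pairs) (int k - int CARD('d))"
proof -
  have "riesz_functional p (monom c k) =
      (\<Sum>i\<le>2 * CARD('d). if i = k then c * moment p (int k - int CARD('d)) else 0)"
    unfolding riesz_functional_def by (intro sum.cong) auto
  then show ?thesis using assms by simp
qed

lemma riesz_functional_add:
  "riesz_functional p (P + Q) = riesz_functional p P + riesz_functional p Q"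
  by (simp add: riesz_functional_def algebra_simps sum.distrib)

lemma riesz_functional_sum:
  "riesz_functional p (sum f A) = (\<Sum>i\<in>A. riesz_functional p (f i))"
  unfolding riesz_functional_def coeff_sum sum_distrib_right by (rule sum.swap)

lemma riesz_functional_trig_curve:
  fixes P :: "complex poly"
  assumes "degree P \<le> 2 * CARD('d)"
  shows "poly P (cis \<theta>) =
    riesz_functional (trig_curve \<theta> :: 'd::{finite,linorder} pairs) P * cis \<theta> ^ CARD('d)"
proof -
  have "riesz_functional (trig_curve \<theta> :: 'd pairs) P * cis \<theta> ^ CARD('d)
      = (\<Sum>k\<le>2 * CARD('d). coeff P k * (cis (of_int (int k - int CARD('d)) * \<theta>) * cis \<theta> ^ CARD('d)))"
    unfolding riesz_functional_def sum_distrib_right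
    by (intro sum.cong refl, subst moment_trig_curve) auto
  also have "\<dots> = (\<Sum>k\<le>2 * CARD('d). coeff P k * cis \<theta> ^ k)"
    by (simp add: Complex.DeMoivre cis_mult algebra_simps)
  also have "\<dots> = poly P (cis \<theta>)"
    using poly_eq_sum[OF assms] by simp
  finally show ?thesis by simp
qed

text \<open>
  The Laurent polynomial \<open>|g|\<^sup>2\<close> is \<open>\<Sum>\<^sub>m \<Sum>\<^sub>n cnj g\<^sub>m * g\<^sub>n * z\<^bsup>n - m\<^esup>\<close>, and \<open>z\<^bsup>n - m\<^esup>\<close> is sent to the
  entry \<open>(m, n)\<close> of the Toeplitz matrix.
\<close>

lemma riesz_functional_square:
  fixes p :: "'d::{finite,linorder} pairs"
  assumes "degree g \<le> CARD('d)"
  shows "riesz_functional p (g * conj_reciprocal CARD('d) g) =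
    toeplitz_form p (\<chi> i. coeff g (index i))"
proof -
  let ?d = "CARD('d)"
  have "g * conj_reciprocal ?d g =
      (\<Sum>n\<le>?d. monom (coeff g n) n) * (\<Sum>m\<le>?d. monom (cnj (coeff g m)) (?d - m))"
    by (simp only: conj_reciprocal_def poly_as_sum_of_monoms'[OF assms])
  also have "\<dots> = (\<Sum>n\<le>?d. \<Sum>m\<le>?d. monom (coeff g n * cnj (coeff g m)) (n + (?d - m)))"
    by (simp add: sum_product mult_monom)
  finally have "riesz_functional p (g * conj_reciprocal ?d g) =
      (\<Sum>n\<le>?d. \<Sum>m\<le>?d. cnj (coeff g m) * moment p (int n - int m) * coeff g n)"
    by (simp add: riesz_functional_sum riesz_functional_monom of_nat_diff mult_ac)
  also have "\<dots> = (\<Sum>m\<le>?d. \<Sum>n\<le>?d. cnj (coeff g m) * moment p (int n - int m) * coeff g n)"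
    by (rule sum.swap)
  also have "\<dots> = toeplitz_form p (\<chi> i. coeff g (index i))"
    unfolding toeplitz_form_def toeplitz_matrix_moment
    by (simp add: sum.reindex_bij_betw[OF bij_betw_index, symmetric])
  finally show ?thesis .
qed

text \<open>
  Since \<open>a\<^sub>1 c + a\<^sub>2 s\<close> is twice the real part of \<open>\<alpha> (c + s i)\<close> with \<open>\<alpha> = (a\<^sub>1 - a\<^sub>2 i) / 2\<close>, the polynomial
  has coefficient \<open>\<alpha>\<close> at \<open>d + k\<close> and \<open>cnj \<alpha>\<close> at \<open>d - k\<close> for the \<open>k\<close>-th pair. One polynomial serves all
  points \<open>p\<close> at once, which allows to compare the separated point with the curve.
\<close>

lemma affine_functional_as_riesz_functional:
  fixes a :: "'d::{finite,linorder} pairs" and b :: real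
  obtains P where "degree P \<le> 2 * CARD('d)"
    and "\<And>p :: 'd::{finite,linorder} pairs. riesz_functional p P = of_real (a \<bullet> p - b)"
proof -
  let ?d = "CARD('d)"
  define \<alpha> where "\<alpha> j = Complex (fst (a $ j) / 2) (- snd (a $ j) / 2)" for j
  define P where "P = (\<Sum>j\<in>UNIV. monom (\<alpha> j) (?d + pos j) + monom (cnj (\<alpha> j)) (?d - pos j))
    + monom (- of_real b) ?d"
  have "degree P \<le> 2 * ?d"
    unfolding P_def
    by (intro degree_add_le degree_sum_le order.trans[OF degree_monom_le])
      (use pos_range(2)[where 'd='d] in \<open>auto intro: le_trans[OF diff_le_self]\<close>)
  moreover have "riesz_functional p P = of_real (a \<bullet> p - b)" for p :: "'d pairs"
  proof -
    have "riesz_functional p (monom (\<alpha> j) (?d + pos j) + monom (cnj (\<alpha> j)) (?d - pos j))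
        = of_real (a $ j \<bullet> p $ j)" for j
      using pos_range[of j]
      by (simp add: riesz_functional_add riesz_functional_monom of_nat_diff moment_def
          x_coeff_def y_coeff_def \<alpha>_def inner_prod_def complex_eq_iff)
    then show ?thesis
      by (simp add: P_def riesz_functional_add riesz_functional_sum riesz_functional_monom
          inner_vec_def moment_def)
  qed
  ultimately show ?thesis by (rule that)
qed

lemma unit_circle_cis:
  assumes "norm z = 1"
  obtains \<theta> where "\<theta> \<in> {0..<2 * pi}" "z = cis \<theta>"
  using that[of "Arg2pi z"] Arg2pi[of z] assms by (simp add: complex_norm_eq_1_exp cis_conv_exp)

lemma trig_curve_in_orbitope: "\<theta> \<in> {0..<2 * pi} \<Longrightarrow> trig_curve \<theta> \<in> caratheodory_orbitope"
  unfolding caratheodory_orbitope_def by (intro hull_inc imageI)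

text \<open>The half-open parameter interval is not compact, but periodicity allows to close it.\<close>

lemma compact_caratheodory_orbitope:
  "compact (caratheodory_orbitope :: 'd::{finite,linorder} pairs set)"
proof -
  have "trig_curve ` {0..<2 * pi} = (trig_curve ` {0..2 * pi} :: 'd pairs set)"
  proof -
    have "trig_curve (2 * pi) = (trig_curve 0 :: 'd pairs)"
      using cos_int_2pin[of "int (pos j)" for j :: 'd] sin_int_2pin[of "int (pos j)" for j :: 'd]
      by (simp add: trig_curve_def vec_eq_iff mult_ac)
    moreover have "{0..2 * pi} = insert (2 * pi) {0..<2 * pi}"
      by auto
    moreover have "trig_curve 0 \<in> (trig_curve ` {0..<2 * pi} :: 'd pairs set)" by simp
    ultimately show ?thesis by (simp add: insert_absorb)
  qed
  moreover have "compact (trig_curve ` {0..2 * pi} :: 'd pairs set)"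
    unfolding trig_curve_def
    by (intro compact_continuous_image continuous_intros) auto
  ultimately show ?thesis
    unfolding caratheodory_orbitope_def by (simp add: compact_convex_hull)
qed

text \<open>
  A functional separating \<open>p\<close> from the orbitope would be a square \<open>|g|\<^sup>2\<close> on the curve, and its value
  at \<open>p\<close> would then be a value of the positive semidefinite Toeplitz form.
\<close>

lemma psd_imp_caratheodory_orbitope:
  fixes p :: "'d::{finite,linorder} pairs"
  assumes "hermitian_psd (toeplitz_matrix p)"
  shows "p \<in> caratheodory_orbitope"
proof (rule ccontr)
  assume "p \<notin> caratheodory_orbitope"
  then obtain a b where ab: "a \<bullet> p < b" "\<And>q. q \<in> caratheodory_orbitope \<Longrightarrow> b < a \<bullet> q"
    using separating_hyperplane_closed_point[of caratheodory_orbitope p]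
      compact_caratheodory_orbitope[THEN compact_imp_closed]
    by (auto simp: caratheodory_orbitope_def)
  obtain P where P: "degree P \<le> 2 * CARD('d)"
    "\<And>q :: 'd pairs. riesz_functional q P = of_real (a \<bullet> q - b)"
    using affine_functional_as_riesz_functional[of a b] by blast
  have "\<exists>r>0. poly P z = of_real r * z ^ CARD('d)" if z: "norm z = 1" for z
  proof -
    obtain \<theta> where \<theta>: "\<theta> \<in> {0..<2 * pi}" "z = cis \<theta>"
      using unit_circle_cis[OF z] by blast
    have "a \<bullet> trig_curve \<theta> - b > 0"
      using ab(2)[OF trig_curve_in_orbitope[OF \<theta>(1)]] by simp
    moreover have "poly P z = of_real (a \<bullet> trig_curve \<theta> - b) * z ^ CARD('d)"
      unfolding \<theta>(2) riesz_functional_trig_curve[OF P(1)] P(2) ..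
    ultimately show ?thesis by blast
  qed
  then obtain g where g: "degree g \<le> CARD('d)" "P = g * conj_reciprocal CARD('d) g"
    using fejer_riesz[OF P(1)] by blast
  have "of_real (a \<bullet> p - b) = toeplitz_form p (\<chi> i. coeff g (index i))"
    using P(2)[of p] riesz_functional_square[OF g(1), of p] g(2) by simp
  then have "a \<bullet> p - b \<ge> 0"
    using assms unfolding hermitian_psd_toeplitz_iff by (metis Re_complex_of_real)
  with ab(1) show False by simp
qed

lemma caratheodory_orbitope_iff_psd:
  "p \<in> caratheodory_orbitope \<longleftrightarrow> hermitian_psd (toeplitz_matrix p)"
  using caratheodory_orbitope_imp_psd psd_imp_caratheodory_orbitope by blast

section \<open>The affine isomorphism\<close>

lemma linear_toeplitz_matrix:
  "linear (\<lambda>p :: 'd::{finite,linorder} pairs. toeplitz_matrix p - toeplitz_matrix 0)"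
proof (rule linearI)
  fix p q :: "'d pairs" and c :: real
  have "moment (p + q) k - moment (0 :: 'd pairs) k =
      (moment p k - moment (0 :: 'd pairs) k) + (moment q k - moment (0 :: 'd pairs) k)" for k
    by (rule linear_add[OF linear_moment])
  then show "toeplitz_matrix (p + q) - toeplitz_matrix 0 =
      (toeplitz_matrix p - toeplitz_matrix 0) + (toeplitz_matrix q - toeplitz_matrix 0)"
    by (simp only: vec_eq_iff toeplitz_matrix_moment vector_minus_component
        vector_add_component simp_thms)
  have "moment (c *\<^sub>R p) k - moment (0 :: 'd pairs) k =
      c *\<^sub>R (moment p k - moment (0 :: 'd pairs) k)" for k
    by (rule linear_cmul[OF linear_moment])
  then show "toeplitz_matrix (c *\<^sub>R p) - toeplitz_matrix 0 =
      c *\<^sub>R (toeplitz_matrix p - toeplitz_matrix 0)"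
    by (simp only: vec_eq_iff toeplitz_matrix_moment vector_minus_component
        vector_scaleR_component simp_thms)
qed

lemma toeplitz_matrix_first_row:
  "toeplitz_matrix p $ None $ Some j = Complex (fst (p $ j)) (snd (p $ j))"
  using pos_range(1)[of j] by (simp add: toeplitz_matrix_def x_coeff_def)

lemma inj_toeplitz_matrix: "inj toeplitz_matrix"
proof (rule injI)
  fix p q :: "'d::{finite,linorder} pairs"
  assume "toeplitz_matrix p = toeplitz_matrix q"
  then have "toeplitz_matrix p $ None $ Some j = toeplitz_matrix q $ None $ Some j" for j
    by simp
  then show "p = q"
    by (simp add: toeplitz_matrix_first_row vec_eq_iff prod_eq_iff)
qed

text \<open>
  The first row of \<open>A\<close> supplies the point. The Toeplitz property moves every entry above the
  diagonal into the first row, and Hermitian symmetry gives the entries below.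
\<close>

lemma toeplitz_matrix_surj:
  fixes A :: "complex ^ ('d::{finite,linorder}) option ^ 'd option"
  assumes herm: "hermitian A" and toep: "is_toeplitz A" and diag: "\<And>i. A $ i $ i = 1"
  obtains p where "A = toeplitz_matrix p"
proof -
  define p where "p = (\<chi> j. (Re (A $ None $ Some j), Im (A $ None $ Some j)))"
  have upper: "A $ m $ n = toeplitz_matrix p $ m $ n" if mn: "index m < index n" for m n
  proof -
    have "pos (inv pos (index n - index m) :: 'd) = index n - index m"
      using mn index_diff_le[of n m] by (intro pos_inv) auto
    then have "A $ m $ n = A $ None $ Some (inv pos (index n - index m))"
      using mn by (intro toep[unfolded is_toeplitz_def, rule_format]) simp
    then show ?thesis
      using mn by (simp add: toeplitz_matrix_def x_coeff_def p_def)
  qed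
  have "A $ m $ n = toeplitz_matrix p $ m $ n" for m n
  proof (cases "index m" "index n" rule: linorder_cases)
    case less
    then show ?thesis by (rule upper)
  next
    case equal
    then have "m = n"
      using bij_betw_imp_inj_on[OF bij_betw_index] by (auto dest: injD)
    then show ?thesis by (simp add: diag toeplitz_matrix_def)
  next
    case greater
    then show ?thesis
      using upper[OF greater] herm hermitian_toeplitz_matrix[of p] unfolding hermitian_def by metis
  qed
  then show ?thesis by (intro that[of p]) (simp add: vec_eq_iff)
qed

lemma is_toeplitz_toeplitz_matrix: "is_toeplitz (toeplitz_matrix p)"
  unfolding is_toeplitz_def toeplitz_matrix_moment by (metis minus_diff_eq)

lemma toeplitz_matrix_diagonal: "toeplitz_matrix p $ i $ i = 1"
  by (simp add: toeplitz_matrix_def)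

lemma bij_betw_toeplitz_matrix:
  "bij_betw toeplitz_matrix
    {p :: 'd::{finite,linorder} pairs. hermitian_psd (toeplitz_matrix p)} toeplitz_spectrahedron"
proof (rule bij_betw_imageI)
  show "inj_on toeplitz_matrix {p :: 'd pairs. hermitian_psd (toeplitz_matrix p)}"
    using inj_toeplitz_matrix by (rule inj_on_subset) simp
  show "toeplitz_matrix ` {p :: 'd pairs. hermitian_psd (toeplitz_matrix p)} = toeplitz_spectrahedron"
  proof (intro equalityI subsetI)
    fix A :: "complex ^ 'd option ^ 'd option"
    assume "A \<in> toeplitz_spectrahedron"
    then have A: "hermitian_psd A" "is_toeplitz A" "\<And>i. A $ i $ i = 1"
      by (auto simp: toeplitz_spectrahedron_def)
    then obtain p where "A = toeplitz_matrix p"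
      using toeplitz_matrix_surj unfolding hermitian_psd_def by blast
    with A(1) show "A \<in> toeplitz_matrix ` {p. hermitian_psd (toeplitz_matrix p)}"
      by blast
  qed (auto simp: toeplitz_spectrahedron_def is_toeplitz_toeplitz_matrix toeplitz_matrix_diagonal)
qed

theorem theorem5p2:
  shows "affine_iso_betw toeplitz_matrix
      (caratheodory_orbitope :: ((real \<times> real) ^ ('d::{finite,linorder})) set)
      toeplitz_spectrahedron
    \<and> (\<forall>p :: (real \<times> real) ^ ('d::{finite,linorder}).
      p \<in> caratheodory_orbitope \<longleftrightarrow> hermitian_psd (toeplitz_matrix p))
    \<and> (\<forall>p :: (real \<times> real) ^ ('d::{finite,linorder}).
      p \<in> caratheodory_orbitope \<longleftrightarrow> real_psd (real_block (toeplitz_matrix p)))"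
proof -
  have orbitope: "(caratheodory_orbitope :: 'd pairs set) = {p. hermitian_psd (toeplitz_matrix p)}"
    using caratheodory_orbitope_iff_psd by auto
  have "affine_iso_betw toeplitz_matrix (caratheodory_orbitope :: 'd pairs set) toeplitz_spectrahedron"
    unfolding affine_iso_betw_def orbitope
    using linear_toeplitz_matrix bij_betw_toeplitz_matrix by blast
  then show ?thesis
    using caratheodory_orbitope_iff_psd hermitian_psd_iff_real_psd by blast
qed

end
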